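(* (Change of scale property.) Let $f:[0,\infty)^4\to\mathbb{C}$ be a function with quadruple Shehu transform $\mathbb{H}^4_{qrst}[f(q,r,s,t)]=F[(h,j,k,l),(m,n,o,p)]$, and let $a,b,c,d>0$. Then for all $h,j,k,l,m,n,o,p>0$ such that $F$ exists at $\left[\left(\frac{h}{a},\frac{j}{b},\frac{k}{c},\frac{l}{d}\right),(m,n,o,p)\right]$, $$\mathbb{H}^4_{qrst}[f(aq,br,cs,dt)]=\frac{1}{abcd}\,F\left[\left(\frac{h}{a},\frac{j}{b},\frac{k}{c},\frac{l}{d}\right),(m,n,o,p)\right],$$ where the left-hand side is evaluated at the parameters $[(h,j,k,l),(m,n,o,p)]$.
   Context: Quadruple Shehu transform: for a real- or complex-valued function $f(q,r,s,t)$ of $q,r,s,t\ge 0$ and parameters (Shehu variables) $h,j,k,l,m,n,o,p>0$, $$\mathbb{H}^4_{qrst}[f(q,r,s,t)]=F[(h,j,k,l),(m,n,o,p)]=\int_0^\infty\int_0^\infty\int_0^\infty\int_0^\infty e^{-\left(\frac{hq}{m}+\frac{jr}{n}+\frac{ks}{o}+\frac{lt}{p}\right)}f(q,r,s,t)\,dq\,dr\,ds\,dt,$$ provided the integral exists (as a Lebesgue integral over $(0,\infty)^4$). *)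

theory Defs
  imports "HOL-Analysis.Analysis"
begin

definition pos_orthant4 :: "(real \<times> real \<times> real \<times> real) set"
  where "pos_orthant4 = {0<..} \<times> {0<..} \<times> {0<..} \<times> {0<..}"

text \<open>The third variable of the second parameter group is called \<open>w\<close> where one would expect
  \<open>o\<close>, because \<open>o\<close> is reserved syntax for function composition.\<close>

definition shehu4_integrand ::
  "(real \<Rightarrow> real \<Rightarrow> real \<Rightarrow> real \<Rightarrow> complex) \<Rightarrow> real \<times> real \<times> real \<times> real \<Rightarrow> real \<times> real \<times> real \<times> real
    \<Rightarrow> real \<times> real \<times> real \<times> real \<Rightarrow> complex"
  where "shehu4_integrand f = (\<lambda>(h, j, k, l) (m, n, w, p) (q, r, s, t).
    complex_of_real (exp (- (h * q / m + j * r / n + k * s / w + l * t / p))) * f q r s t)"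

text \<open>Functions on \<open>[0,\<infinity>)\<^sup>4\<close> are represented by total functions; only the values on
  the open orthant enter the transform.\<close>

definition shehu4_exists ::
  "(real \<Rightarrow> real \<Rightarrow> real \<Rightarrow> real \<Rightarrow> complex) \<Rightarrow> real \<times> real \<times> real \<times> real \<Rightarrow> real \<times> real \<times> real \<times> real \<Rightarrow> bool"
  where "shehu4_exists f H M \<longleftrightarrow> set_integrable lebesgue pos_orthant4 (shehu4_integrand f H M)"

definition shehu4 ::
  "(real \<Rightarrow> real \<Rightarrow> real \<Rightarrow> real \<Rightarrow> complex) \<Rightarrow> real \<times> real \<times> real \<times> real \<Rightarrow> real \<times> real \<times> real \<times> real \<Rightarrow> complex"
  where "shehu4 f H M = set_lebesgue_integral lebesgue pos_orthant4 (shehu4_integrand f H M)"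

end

theory Submission
  imports Defs
begin

text \<open>The substitution (q,r,s,t) -> (aq,br,cs,dt) maps the open orthant onto itself,
  multiplies volume by abcd, and turns the kernel with parameters h/a, j/b, k/c, l/d into the one
  with h, j, k, l, since (h/a)(aq) = hq and likewise for the others.
  \<open>has_bochner_integral_lebesgue_scale4\<close> carries this out; stating it with
  \<open>has_bochner_integral\<close> yields existence and value of the transform together.\<close>

lemma has_bochner_integral_lebesgue_affine:
  fixes g :: "'a::euclidean_space \<Rightarrow> 'b::{banach, second_countable_topology}"
    and c :: "'a \<Rightarrow> real" and t :: 'a
  defines "T x \<equiv> t + (\<Sum>i\<in>Basis. (c i * (x \<bullet> i)) *\<^sub>R i)"
  assumes c: "\<And>i. i \<in> Basis \<Longrightarrow> c i \<noteq> 0"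
    and g: "has_bochner_integral lebesgue g I"
  shows "has_bochner_integral lebesgue (\<lambda>x. g (T x)) (I /\<^sub>R (\<Prod>i\<in>Basis. \<bar>c i\<bar>))"
proof -
  define K where "K = (\<Prod>i\<in>Basis. \<bar>c i\<bar>)"
  have K: "K > 0"
    using c by (simp add: K_def prod_pos)
  have T: "T \<in> lebesgue \<rightarrow>\<^sub>M lebesgue"
    unfolding T_def using c by (rule lebesgue_affine_measurable)
  \<comment> \<open>Lebesgue measure is \<open>K\<close> times its own image under \<open>T\<close>;
    both integrability and the value follow from this one identity.\<close>
  have eq: "(lebesgue :: 'a measure) = density (distr lebesgue lebesgue T) (\<lambda>_. ennreal K)"
    unfolding T_def K_def
    by (subst lebesgue_affine_euclidean[where c = c and t = t]) (simp_all add: c prod_ennreal)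
  have meas: "g \<in> borel_measurable lebesgue"
    using g by (rule borel_measurable_has_bochner_integral)
  then have meas': "g \<in> borel_measurable (distr lebesgue lebesgue T)"
    by simp
  have "integrable (distr lebesgue lebesgue T) (\<lambda>x. K *\<^sub>R g x)"
    using g K meas' by (subst (asm) eq) (simp add: has_bochner_integral_iff integrable_density)
  \<comment> \<open>Multiplying by \<open>inverse K\<close> cancels the constant density, which is
    possible because \<open>K\<close> is positive.\<close>
  then have "integrable (distr lebesgue lebesgue T) (\<lambda>x. inverse K *\<^sub>R K *\<^sub>R g x)"
    by (rule integrable_scaleR_right)
  then have int: "integrable lebesgue (\<lambda>x. g (T x))"
    using K meas T by (simp add: integrable_distr_eq)
  have "I = integral\<^sup>L (density (distr lebesgue lebesgue T) (\<lambda>_. ennreal K)) g"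
    using g by (subst eq[symmetric]) (simp add: has_bochner_integral_iff)
  also have "\<dots> = K *\<^sub>R integral\<^sup>L lebesgue (\<lambda>x. g (T x))"
    using K meas meas' T by (simp add: integral_density integral_distr)
  finally show ?thesis
    using int K by (simp add: K_def[symmetric] has_bochner_integral_iff)
qed

text \<open>The affine lemma with zero translation: taking inner products of
  \<open>(a, b, c, d)\<close> with the standard basis vectors of the product space gives the four
  scaling factors.\<close>

lemma has_bochner_integral_lebesgue_scale4:
  fixes g :: "real \<times> real \<times> real \<times> real \<Rightarrow> 'b::{banach, second_countable_topology}"
  assumes "a \<noteq> 0" "b \<noteq> 0" "c \<noteq> 0" "d \<noteq> 0"
    and "has_bochner_integral lebesgue g I"
  shows "has_bochner_integral lebesgue (\<lambda>(q, r, s, t). g (a * q, b * r, c * s, d * t))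
    (I /\<^sub>R \<bar>a * b * c * d\<bar>)"
proof -
  let ?v = "(a, b, c, d)"
  have "has_bochner_integral lebesgue
      (\<lambda>x. g (0 + (\<Sum>i\<in>Basis. ((?v \<bullet> i) * (x \<bullet> i)) *\<^sub>R i))) (I /\<^sub>R (\<Prod>i\<in>Basis. \<bar>?v \<bullet> i\<bar>))"
    using assms by (intro has_bochner_integral_lebesgue_affine) (auto simp: Basis_prod_def)
  moreover have "(\<Prod>i\<in>Basis. \<bar>?v \<bullet> i\<bar>) = \<bar>a * b * c * d\<bar>"
    by (simp add: Basis_prod_def image_Un image_image prod.union_disjoint abs_mult)
  moreover have "0 + (\<Sum>i\<in>Basis. ((?v \<bullet> i) * (x \<bullet> i)) *\<^sub>R i)
      = (case x of (q, r, s, t) \<Rightarrow> (a * q, b * r, c * s, d * t))" for x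
    by (cases x) (simp add: Basis_prod_def image_Un image_image)
  ultimately show ?thesis
    by (simp add: case_prod_unfold)
qed

theorem mainTheorem2:
  fixes f :: "real \<Rightarrow> real \<Rightarrow> real \<Rightarrow> real \<Rightarrow> complex"
    and a b c d h j k l m n w p :: real
  assumes "a > 0" "b > 0" "c > 0" "d > 0"
    and "h > 0" "j > 0" "k > 0" "l > 0"
    and "m > 0" "n > 0" "w > 0" "p > 0"
    and "shehu4_exists f (h / a, j / b, k / c, l / d) (m, n, w, p)"
  shows "shehu4_exists (\<lambda>q r s t. f (a * q) (b * r) (c * s) (d * t)) (h, j, k, l) (m, n, w, p)
    \<and> shehu4 (\<lambda>q r s t. f (a * q) (b * r) (c * s) (d * t)) (h, j, k, l) (m, n, w, p)
      = complex_of_real (1 / (a * b * c * d)) * shehu4 f (h / a, j / b, k / c, l / d) (m, n, w, p)"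
proof -
  \<comment> \<open>The indicator is kept inside the integrand so that the substitution can be made
    over the whole space.\<close>
  let ?g = "\<lambda>x. indicator pos_orthant4 x *\<^sub>R
    shehu4_integrand f (h / a, j / b, k / c, l / d) (m, n, w, p) x"
  let ?g' = "\<lambda>x. indicator pos_orthant4 x *\<^sub>R
    shehu4_integrand (\<lambda>q r s t. f (a * q) (b * r) (c * s) (d * t)) (h, j, k, l) (m, n, w, p) x"
  have "has_bochner_integral lebesgue ?g (shehu4 f (h / a, j / b, k / c, l / d) (m, n, w, p))"
    using assms(13) unfolding shehu4_exists_def shehu4_def set_integrable_def
      set_lebesgue_integral_def by (rule has_bochner_integral_integrable)
  then have "has_bochner_integral lebesgue (\<lambda>(q, r, s, t). ?g (a * q, b * r, c * s, d * t))
      (shehu4 f (h / a, j / b, k / c, l / d) (m, n, w, p) /\<^sub>R \<bar>a * b * c * d\<bar>)"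
    using assms by (intro has_bochner_integral_lebesgue_scale4) auto
  \<comment> \<open>Positivity of the factors, not just their being nonzero, makes the indicators
    agree: \<open>a * q\<close> is positive exactly when \<open>q\<close> is. On the orthant the
    factors cancel in the exponent; off it both sides vanish.\<close>
  moreover have "(\<lambda>(q, r, s, t). ?g (a * q, b * r, c * s, d * t)) = ?g'"
    using assms(1-4) by (auto simp: fun_eq_iff shehu4_integrand_def pos_orthant4_def
        indicator_def zero_less_mult_iff)
  ultimately have "has_bochner_integral lebesgue ?g'
      (shehu4 f (h / a, j / b, k / c, l / d) (m, n, w, p) /\<^sub>R (a * b * c * d))"
    using assms(1-4) by simp
  then show ?thesis
    by (simp add: has_bochner_integral_iff shehu4_exists_def shehu4_def set_integrable_def
        set_lebesgue_integral_def scaleR_conv_of_real divide_inverse)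
qed

end
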